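(* Let $f(w)=\frac12(xw-y)^2$ be a one-dimensional quadratic ($w,x,y\in\mathbb{R}$, $x\ne0$), with smoothness constant $L=x^2$ and minimizer $w^*$. Let $1\le\beta<T$, and run gradient descent $w_{k+1}=w_k-\gamma_k\alpha_kf'(w_k)$, $k\ge1$, with $\alpha_k=\left(\frac\beta T\right)^{k/T}$ and $\gamma_k=\frac\nu L$ for some $\nu>3$. Then for all $k\ge1$ $$w_{k+1}-w^*=(w_1-w^* )\prod_{i=1}^k(1-\nu\alpha_i).$$ Moreover, with $k':=\left\lfloor\frac{T}{\ln(T/\beta)}\ln\left(\frac\nu3\right)\right\rfloor$, after $k'$ iterations $$|w_{k'+1}-w^*|\ge2^{k'}|w_1-w^*|.$$
   Context: $T$ is a positive integer (the horizon) and $\beta$ a constant; the recursion is run with the given formula for $\alpha_k$ for every $k\ge 1$ needed. *)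

theory Defs
  imports "HOL-Analysis.Analysis"
begin

definition quad_loss :: "real \<Rightarrow> real \<Rightarrow> real \<Rightarrow> real" where
  "quad_loss x y w = 1 / 2 * (x * w - y)\<^sup>2"

definition exp_step :: "real \<Rightarrow> nat \<Rightarrow> nat \<Rightarrow> real" where
  "exp_step \<beta> T k = (\<beta> / real T) powr (real k / real T)"

(* Iterates are numbered from 1; the value w 0 is unconstrained and never used. *)
definition gradient_descent ::
  "(real \<Rightarrow> real) \<Rightarrow> (nat \<Rightarrow> real) \<Rightarrow> (nat \<Rightarrow> real) \<Rightarrow> (nat \<Rightarrow> real) \<Rightarrow> bool" where
  "gradient_descent f \<gamma> \<alpha> w \<longleftrightarrow>
     (\<forall>k\<ge>1. w (k + 1) = w k - \<gamma> k * \<alpha> k * deriv f (w k))"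

lemma deriv_quad_loss: "deriv (quad_loss x y) w = x * (x * w - y)"
proof -
  have "(quad_loss x y has_real_derivative x * (x * w - y)) (at w)"
    unfolding quad_loss_def [abs_def]
    by (auto intro!: derivative_eq_intros simp: power2_eq_square algebra_simps)
  then show ?thesis
    by (rule DERIV_imp_deriv)
qed

(* x^2 is the smoothness constant: the least Lipschitz constant of the derivative. *)
lemma quad_loss_smoothness:
  "(x\<^sup>2)-lipschitz_on UNIV (deriv (quad_loss x y))"
  "M-lipschitz_on UNIV (deriv (quad_loss x y)) \<Longrightarrow> x\<^sup>2 \<le> M"
proof -
  have d: "dist (deriv (quad_loss x y) u) (deriv (quad_loss x y) v) = x\<^sup>2 * dist u v" for u v
  proof -
    have "x * (x * u - y) - x * (x * v - y) = x\<^sup>2 * (u - v)"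
      by (simp add: power2_eq_square algebra_simps)
    then show ?thesis
      by (simp add: deriv_quad_loss dist_real_def abs_mult)
  qed
  show "(x\<^sup>2)-lipschitz_on UNIV (deriv (quad_loss x y))"
    by (rule lipschitz_onI) (simp_all add: d)
  show "x\<^sup>2 \<le> M" if "M-lipschitz_on UNIV (deriv (quad_loss x y))"
    using lipschitz_onD [OF that, of 1 0] by (simp add: d)
qed

lemma quad_loss_minimizer:
  assumes "x \<noteq> 0"
  shows "is_arg_min (quad_loss x y) (\<lambda>_. True) u \<longleftrightarrow> u = y / x"
proof
  assume "is_arg_min (quad_loss x y) (\<lambda>_. True) u"
  then have "\<not> quad_loss x y (y / x) < quad_loss x y u"
    by (simp add: is_arg_min_def)
  then have "(x * u - y)\<^sup>2 = 0"
    using assms by (simp add: quad_loss_def)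
  then show "u = y / x"
    using assms by (simp add: field_simps)
next
  assume "u = y / x"
  then show "is_arg_min (quad_loss x y) (\<lambda>_. True) u"
    using assms by (simp add: is_arg_min_def quad_loss_def not_less)
qed

end

theory Submission
  imports Defs
begin

text \<open>
  The derivative of a one-dimensional quadratic is \<open>L\<close> times the signed distance to the
  minimizer, so a step of length \<open>\<nu> / L\<close>, scaled by \<open>\<alpha>\<^sub>i\<close>, multiplies that distance by exactly
  \<open>1 - \<nu> \<alpha>\<^sub>i\<close> (\<open>quad_gradient_step_error\<close>), and the errors telescope into a product.

  The schedule \<open>\<alpha>\<^sub>i = exp (- (i / T) ln (T / \<beta>))\<close> decreases in \<open>i\<close>, and \<open>k'\<close>
  is the last index at which \<open>\<nu> \<alpha>\<^sub>i\<close> is still at least \<open>3\<close> (\<open>exp_step_ge_imp\<close>).  Up to then every factor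
  has absolute value at least \<open>3 - 1 = 2\<close>, which gives the growth by \<open>2\<close> to the power \<open>k'\<close>.
\<close>

lemma quad_gradient_step_error:
  assumes "x \<noteq> 0"
  shows "(u - \<nu> / x\<^sup>2 * a * deriv (quad_loss x y) u) - y / x = (u - y / x) * (1 - \<nu> * a)"
  using assms by (simp add: deriv_quad_loss field_simps power2_eq_square)

lemma gradient_descent_quad_loss_error:
  assumes "x \<noteq> 0"
    and gd: "gradient_descent (quad_loss x y) (\<lambda>_. \<nu> / x\<^sup>2) \<alpha> w"
  shows "w (k + 1) - y / x = (w 1 - y / x) * (\<Prod>i=1..k. 1 - \<nu> * \<alpha> i)"
proof (induction k)
  case 0
  show ?case by simp
next
  case (Suc k)
  have "w (Suc k + 1)
      = w (Suc k) - \<nu> / x\<^sup>2 * \<alpha> (Suc k) * deriv (quad_loss x y) (w (Suc k))"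
    using gd unfolding gradient_descent_def by (metis le_add2 plus_1_eq_Suc le_add1)
  then have "w (Suc k + 1) - y / x = (w (Suc k) - y / x) * (1 - \<nu> * \<alpha> (Suc k))"
    using quad_gradient_step_error [OF \<open>x \<noteq> 0\<close>] by metis
  with Suc show ?case
    by (simp add: mult.assoc)
qed

text \<open>
  Taking logarithms in \<open>exp_step \<beta> T i \<ge> c / \<nu>\<close> turns it into a linear bound on \<open>i\<close>; dividing by
  \<open>ln (T / \<beta>)\<close> preserves the order because \<open>\<beta> < T\<close> makes this logarithm positive.
\<close>

lemma exp_step_ge_imp:
  assumes "0 < \<beta>" "\<beta> < real T" "0 < c" "0 < \<nu>"
    and i: "real i \<le> real T / ln (real T / \<beta>) * ln (\<nu> / c)"
  shows "c \<le> \<nu> * exp_step \<beta> T i"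
proof -
  have T: "real T > 0" using assms by linarith
  have pos: "ln (real T / \<beta>) > 0" using assms by simp
  have "real i * ln (real T / \<beta>) \<le> real T * ln (\<nu> / c)"
    using i pos by (simp add: field_simps)
  then have "real i / real T * ln (real T / \<beta>) \<le> ln (\<nu> / c)"
    using T by (simp add: field_simps)
  then have "ln (c / \<nu>) \<le> real i / real T * ln (\<beta> / real T)"
    using assms T by (simp add: ln_div algebra_simps)
  then have "exp (ln (c / \<nu>)) \<le> exp (real i / real T * ln (\<beta> / real T))"
    by (simp only: exp_le_cancel_iff)
  then have "c / \<nu> \<le> exp_step \<beta> T i"
    using assms T by (simp add: exp_step_def powr_def)
  then show ?thesis
    using assms by (simp add: field_simps)
qed

lemma power_le_abs_prod:
  fixes f :: "'a \<Rightarrow> 'b::linordered_field"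
  assumes "0 \<le> c" "\<And>i. i \<in> A \<Longrightarrow> c \<le> \<bar>f i\<bar>"
  shows "c ^ card A \<le> \<bar>\<Prod>i\<in>A. f i\<bar>"
  using prod_mono [of A "\<lambda>_. c" "\<lambda>i. \<bar>f i\<bar>"] assms by (simp add: abs_prod)

theorem theorem5:
  fixes x y L wstar \<beta> \<nu> :: real
    and T k' :: nat
    and \<alpha> \<gamma> w :: "nat \<Rightarrow> real"
  assumes "x \<noteq> 0"
    and "L = x\<^sup>2"
    and "is_arg_min (quad_loss x y) (\<lambda>_. True) wstar"
    and "T > 0"
    and "1 \<le> \<beta>" and "\<beta> < real T"
    and "\<nu> > 3"
    and "\<And>k. \<alpha> k = exp_step \<beta> T k"
    and "\<And>k. \<gamma> k = \<nu> / L"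
    and "gradient_descent (quad_loss x y) \<gamma> \<alpha> w"
    and "k' = nat \<lfloor>real T / ln (real T / \<beta>) * ln (\<nu> / 3)\<rfloor>"
  shows "(\<forall>k\<ge>1. w (k + 1) - wstar = (w 1 - wstar) * (\<Prod>i=1..k. 1 - \<nu> * \<alpha> i)) \<and>
         \<bar>w (k' + 1) - wstar\<bar> \<ge> 2 ^ k' * \<bar>w 1 - wstar\<bar>"
proof -
  let ?b = "real T / ln (real T / \<beta>) * ln (\<nu> / 3)"
  have wstar: "wstar = y / x"
    using quad_loss_minimizer assms(1,3) by blast
  have "\<gamma> = (\<lambda>_. \<nu> / x\<^sup>2)"
    using assms(2,9) by auto
  then have err: "w (k + 1) - wstar = (w 1 - wstar) * (\<Prod>i=1..k. 1 - \<nu> * \<alpha> i)" for k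
    using gradient_descent_quad_loss_error assms(1,10) wstar by blast
  have "?b \<ge> 0"
    using assms(5-7) by simp
  then have k'_le: "real k' \<le> ?b"
    using assms(11) by simp
  have factor: "2 \<le> \<bar>1 - \<nu> * \<alpha> i\<bar>" if "i \<in> {1..k'}" for i
  proof -
    have "real i \<le> ?b"
      using that k'_le by simp
    then have "3 \<le> \<nu> * \<alpha> i"
      using exp_step_ge_imp [of \<beta> T 3 \<nu> i] assms(5-8) by simp
    then show ?thesis by linarith
  qed
  have "2 ^ k' \<le> \<bar>\<Prod>i=1..k'. 1 - \<nu> * \<alpha> i\<bar>"
    using power_le_abs_prod [of 2 "{1..k'}", OF _ factor] by simp
  then have "2 ^ k' * \<bar>w 1 - wstar\<bar> \<le> \<bar>w (k' + 1) - wstar\<bar>"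
    unfolding err abs_mult by (subst mult.commute) (rule mult_left_mono, simp_all)
  with err show ?thesis by blast
qed

end
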